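(* For each integer $n \geq 1$, let $M_n$ be the maximum of $|\mathcal{A}|\,|\mathcal{B}|$ over all left-cancellative pairs $(\mathcal{A},\mathcal{B})$ over $[n]$. Then $M_n = 3^{n-o(n)}$ as $n \to \infty$.
   Context: Here $[n] = \{1,\dots,n\}$. A pair $(\mathcal{A},\mathcal{B})$ of families of subsets of $[n]$ is left-cancellative over $[n]$ if for all $A, A' \in \mathcal{A}$ and all $B \in \mathcal{B}$, $A \setminus B = A' \setminus B$ implies $A = A'$. The notation $M_n = 3^{n-o(n)}$ means $\lim_{n\to\infty} \frac{1}{n}\log_3 M_n = 1$. *)

theory Defs
  imports Complex_Main
begin

definition left_cancellative :: "nat \<Rightarrow> nat set set \<Rightarrow> nat set set \<Rightarrow> bool" where
  "left_cancellative n \<A> \<B> \<longleftrightarrow>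
     \<A> \<subseteq> Pow {1..n} \<and> \<B> \<subseteq> Pow {1..n} \<and>
     (\<forall>A\<in>\<A>. \<forall>A'\<in>\<A>. \<forall>B\<in>\<B>. A - B = A' - B \<longrightarrow> A = A')"

definition max_left_cancellative :: "nat \<Rightarrow> nat" where
  "max_left_cancellative n = Max {card \<A> * card \<B> |\<A> \<B>. left_cancellative n \<A> \<B>}"

text \<open>The maximum ranges over a finite nonempty set, so \<open>Max\<close> is a genuine maximum.\<close>

lemma finite_left_cancellative_products:
  "finite {card \<A> * card \<B> |\<A> \<B>. left_cancellative n \<A> \<B>}"
proof (rule finite_subset)
  show "{card \<A> * card \<B> |\<A> \<B>. left_cancellative n \<A> \<B>}
      \<subseteq> (\<lambda>(\<A>, \<B>). card \<A> * card \<B>) ` (Pow (Pow {1..n}) \<times> Pow (Pow {1..n}))"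
    by (force simp: left_cancellative_def)
qed simp

lemma left_cancellative_products_nonempty:
  "{card \<A> * card \<B> |\<A> \<B>. left_cancellative n \<A> \<B>} \<noteq> {}"
proof -
  have "left_cancellative n {} {}" by (simp add: left_cancellative_def)
  then show ?thesis by blast
qed

end

theory Submission
  imports Defs "HOL-Real_Asymp.Real_Asymp"
begin

text \<open>
  The upper bound \<open>3 ^ n\<close> holds because \<open>(A, B) \<mapsto> (A - B, B)\<close> is injective on
  \<open>\<A> \<times> \<B>\<close> with values in the pairs of disjoint subsets of \<open>[n]\<close>.

  For the lower bound, fix a size \<open>b\<close> for which \<open>(n choose b) * 2 ^ (n - b)\<close> is maximal, hence at
  least \<open>3 ^ n / (n + 1)\<close>. Imposing \<open>b + 1\<close> parity conditions \<open>\<bar>A \<inter> S\<bar>\<close> gives a family \<open>\<A>\<close> of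
  size at least \<open>2 ^ (n - b - 1)\<close>. A random \<open>S\<close> meets a fixed nonempty set \<open>V\<close> evenly
  with probability one half, so the conditions can be chosen one after another such that for at
  most half of the \<open>b\<close>-sets \<open>B\<close> some nonempty \<open>V \<subseteq> B\<close> is a symmetric difference of two members of
  \<open>\<A>\<close>. The remaining \<open>b\<close>-sets form \<open>\<B>\<close>.
\<close>

text \<open>Toggling a fixed \<open>v \<in> V\<close> is an involution on \<open>Pow N\<close> that
  flips the parity of \<open>card (V \<inter> S)\<close>, so even and odd subsets are
  equinumerous.\<close>

lemma card_even_Int_subsets:
  assumes "finite N" "V \<subseteq> N" "V \<noteq> {}"
  shows "2 * card {S \<in> Pow N. even (card (V \<inter> S))} = 2 ^ card N"
proof -
  obtain v where v: "v \<in> V" using assms by blast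
  have fV: "finite V" using assms finite_subset by blast
  let ?t = "\<lambda>S. if v \<in> S then S - {v} else insert v S"
  let ?E = "{S \<in> Pow N. even (card (V \<inter> S))}" and ?O = "{S \<in> Pow N. odd (card (V \<inter> S))}"
  have toggle: "even (card (V \<inter> ?t S)) \<longleftrightarrow> odd (card (V \<inter> S))" for S
  proof (cases "v \<in> S")
    case True
    then have "V \<inter> S = insert v (V \<inter> (S - {v}))" using v by blast
    moreover have "card (insert v (V \<inter> (S - {v}))) = Suc (card (V \<inter> (S - {v})))"
      using fV by simp
    ultimately show ?thesis using True by simp
  next
    case False
    then have "V \<inter> insert v S = insert v (V \<inter> S)" using v by blast
    then show ?thesis using False fV by simp
  qed
  have inv: "?t (?t S) = S" for S by auto
  have "bij_betw ?t ?E ?O"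
  proof (rule bij_betw_byWitness[where f' = ?t])
    show "\<forall>S\<in>?E. ?t (?t S) = S" "\<forall>S\<in>?O. ?t (?t S) = S" using inv by blast+
    have sub: "?t S \<subseteq> N" if "S \<subseteq> N" for S using that v assms(2) by auto
    show "?t ` ?E \<subseteq> ?O" "?t ` ?O \<subseteq> ?E" using toggle sub by blast+
  qed
  then have "card ?E = card ?O" by (rule bij_betw_same_card)
  moreover have "card ?E + card ?O = card (?E \<union> ?O)"
    using assms(1) by (intro card_Un_disjoint[symmetric]) auto
  moreover have "?E \<union> ?O = Pow N" by blast
  ultimately show ?thesis using assms(1) by (simp add: card_Pow)
qed

text \<open>Averaging over \<open>S\<close>: if every \<open>S\<close> kept more than half of
  \<open>P\<close>, exchanging the two sums would contradict that each \<open>f p\<close> meets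
  exactly half of all \<open>S\<close> evenly.\<close>

lemma exists_halving_parity:
  fixes f :: "'p \<Rightarrow> 'a set"
  assumes "finite N" "finite P" "\<And>p. p \<in> P \<Longrightarrow> f p \<subseteq> N \<and> f p \<noteq> {}"
  shows "\<exists>S\<subseteq>N. 2 * card {p \<in> P. even (card (f p \<inter> S))} \<le> card P"
proof (rule ccontr)
  assume "\<not> ?thesis"
  then have "\<And>S. S \<in> Pow N \<Longrightarrow> card P < 2 * card {p \<in> P. even (card (f p \<inter> S))}"
    by (auto simp: not_le)
  then have "(\<Sum>S\<in>Pow N. card P) < (\<Sum>S\<in>Pow N. 2 * card {p \<in> P. even (card (f p \<inter> S))})"
    using assms(1) by (intro sum_strict_mono) auto
  also have "\<dots> = 2 * (\<Sum>S\<in>Pow N. \<Sum>p | p \<in> P \<and> even (card (f p \<inter> S)). 1)"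
    by (simp add: sum_distrib_left)
  also have "\<dots> = 2 * (\<Sum>p\<in>P. \<Sum>S | S \<in> Pow N \<and> even (card (f p \<inter> S)). 1)"
    using assms by (subst sum.swap_restrict) auto
  also have "\<dots> = (\<Sum>p\<in>P. 2 * card {S \<in> Pow N. even (card (f p \<inter> S))})"
    by (simp add: sum_distrib_left)
  also have "\<dots> = (\<Sum>p\<in>P. 2 ^ card N)"
    using assms by (intro sum.cong refl card_even_Int_subsets) auto
  finally show False using assms(1) by (simp add: card_Pow)
qed

text \<open>The common part \<open>X \<inter> Y \<inter> S\<close> is counted twice in the sum of
  the two cardinalities and so drops out modulo 2.\<close>

lemma even_card_sym_diff_Int:
  assumes "finite X" "finite Y"
  shows "even (card (sym_diff X Y \<inter> S)) \<longleftrightarrow> (even (card (X \<inter> S)) \<longleftrightarrow> even (card (Y \<inter> S)))"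
proof -
  have "sym_diff X Y \<inter> S = ((X \<inter> S) - (X \<inter> Y \<inter> S)) \<union> ((Y \<inter> S) - (X \<inter> Y \<inter> S))" by blast
  moreover have "card \<dots> = card ((X \<inter> S) - (X \<inter> Y \<inter> S)) + card ((Y \<inter> S) - (X \<inter> Y \<inter> S))"
    using assms by (intro card_Un_disjoint) auto
  moreover have "card (X \<inter> S) = card ((X \<inter> S) - (X \<inter> Y \<inter> S)) + card (X \<inter> Y \<inter> S)"
    using assms by (subst card_Un_disjoint[symmetric]) (auto intro!: arg_cong[of _ _ card])
  moreover have "card (Y \<inter> S) = card ((Y \<inter> S) - (X \<inter> Y \<inter> S)) + card (X \<inter> Y \<inter> S)"
    using assms by (subst card_Un_disjoint[symmetric]) (auto intro!: arg_cong[of _ _ card])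
  ultimately show ?thesis by presburger
qed

text \<open>Each parity condition keeps at least half of the family and at most half of the bad
  indices. Indexing by \<open>p\<close> lets one set \<open>f p\<close> count with multiplicity,
  once for each \<open>B\<close> containing it in the application.\<close>

lemma exists_family_few_sym_diffs:
  fixes f :: "'p \<Rightarrow> 'a set"
  assumes "finite N" "finite P" "\<And>p. p \<in> P \<Longrightarrow> f p \<subseteq> N \<and> f p \<noteq> {}"
  shows "\<exists>\<A>\<subseteq>Pow N. 2 ^ card N \<le> card \<A> * 2 ^ m \<and>
           card {p \<in> P. \<exists>X\<in>\<A>. \<exists>Y\<in>\<A>. f p = sym_diff X Y} * 2 ^ m \<le> card P"
proof (induction m)
  case 0
  show ?case using assms by (intro exI[of _ "Pow N"]) (auto simp: card_Pow intro!: card_mono)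
next
  case (Suc m)
  define bad where "bad \<A> = {p \<in> P. \<exists>X\<in>\<A>. \<exists>Y\<in>\<A>. f p = sym_diff X Y}" for \<A>
  obtain \<A> where \<A>: "\<A> \<subseteq> Pow N" "2 ^ card N \<le> card \<A> * 2 ^ m" "card (bad \<A>) * 2 ^ m \<le> card P"
    using Suc unfolding bad_def by blast
  have fbad: "finite (bad \<A>)" using assms(2) by (simp add: bad_def)
  obtain S where S: "S \<subseteq> N" "2 * card {p \<in> bad \<A>. even (card (f p \<inter> S))} \<le> card (bad \<A>)"
    using exists_halving_parity[OF assms(1) fbad, of f] assms(3) by (auto simp: bad_def)
  define \<E> where "\<E> = {X \<in> \<A>. even (card (X \<inter> S))}"
  have fA: "finite \<A>" using \<A>(1) assms(1) by (meson finite_Pow_iff finite_subset)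
  have "card \<A> = card \<E> + card (\<A> - \<E>)"
    using fA by (subst card_Un_disjoint[symmetric]) (auto simp: \<E>_def intro!: arg_cong[of _ _ card])
  \<comment> \<open>The larger parity class is kept. Either class will do: two sets of equal parity
    on \<open>S\<close> have a symmetric difference meeting \<open>S\<close> evenly.\<close>
  then obtain \<C> where \<C>: "\<C> = \<E> \<or> \<C> = \<A> - \<E>" "card \<A> \<le> 2 * card \<C>"
    by (metis add_mono mult_2 nle_le)
  have sub: "\<C> \<subseteq> \<A>" using \<C>(1) by (auto simp: \<E>_def)
  have "bad \<C> \<subseteq> {p \<in> bad \<A>. even (card (f p \<inter> S))}"
  proof
    fix p assume "p \<in> bad \<C>"
    then obtain X Y where XY: "p \<in> P" "X \<in> \<C>" "Y \<in> \<C>" "f p = sym_diff X Y"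
      by (auto simp: bad_def)
    have "finite X" "finite Y" using XY sub \<A>(1) assms(1) by (meson PowD finite_subset subsetD)+
    moreover have "even (card (X \<inter> S)) \<longleftrightarrow> even (card (Y \<inter> S))"
      using XY \<C>(1) by (auto simp: \<E>_def)
    ultimately have "even (card (f p \<inter> S))" using even_card_sym_diff_Int XY(4) by metis
    moreover have "p \<in> bad \<A>" using XY sub unfolding bad_def by blast
    ultimately show "p \<in> {p \<in> bad \<A>. even (card (f p \<inter> S))}" by blast
  qed
  then have "card (bad \<C>) \<le> card {p \<in> bad \<A>. even (card (f p \<inter> S))}"
    using fbad by (intro card_mono) auto
  then have "2 * card (bad \<C>) \<le> card (bad \<A>)" using S(2) by linarith
  then have "2 * card (bad \<C>) * 2 ^ m \<le> card P"
    using \<A>(3) by (meson le_trans mult_le_mono1)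
  moreover have "2 ^ card N \<le> 2 * card \<C> * 2 ^ m"
    using \<A>(2) \<C>(2) by (meson le_trans mult_le_mono1)
  moreover have "\<C> \<subseteq> Pow N" using sub \<A>(1) by blast
  ultimately show ?case unfolding bad_def by (intro exI[of _ \<C>]) (simp add: mult_ac)
qed

text \<open>In the factor 4, one 2 pays for the last parity condition and the other for discarding
  up to half of the \<open>b\<close>-sets.\<close>

lemma max_left_cancellative_ge_binomial:
  "(n choose b) * 2 ^ n \<le> 4 * 2 ^ b * max_left_cancellative n"
proof -
  define U where "U = {B. B \<subseteq> {1..n} \<and> card B = b}"
  define P where "P = Sigma U (\<lambda>B. Pow B - {{}})"
  have fU: "finite U" unfolding U_def by simp
  have fB: "finite B" if "B \<in> U" for B using that finite_subset unfolding U_def by blast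
  have cU: "card U = n choose b" unfolding U_def using n_subsets[of "{1..n}" b] by simp
  have fP: "finite P" unfolding P_def using fU fB by auto
  have "card P = (\<Sum>B\<in>U. card (Pow B - {{}}))" unfolding P_def using fU fB by simp
  also have "\<dots> \<le> (\<Sum>B\<in>U. 2 ^ b)"
  proof (rule sum_mono)
    fix B assume B: "B \<in> U"
    have "card (Pow B - {{}}) \<le> card (Pow B)" using fB[OF B] by (intro card_mono) auto
    then show "card (Pow B - {{}}) \<le> 2 ^ b" using B fB[OF B] by (simp add: card_Pow U_def)
  qed
  finally have cP: "card P \<le> (n choose b) * 2 ^ b" by (simp add: cU)
  define bad where "bad \<A> = {p \<in> P. \<exists>X\<in>\<A>. \<exists>Y\<in>\<A>. snd p = sym_diff X Y}" for \<A>
  \<comment> \<open>Each \<open>B\<close> contributes fewer than \<open>2 ^ b\<close> pairs, so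
    \<open>b\<close> conditions leave at most \<open>card U\<close> bad pairs; one more brings this
    down to half of \<open>card U\<close>.\<close>
  have "\<exists>\<A>\<subseteq>Pow {1..n}. 2 ^ card {1..n} \<le> card \<A> * 2 ^ Suc b \<and> card (bad \<A>) * 2 ^ Suc b \<le> card P"
    unfolding bad_def by (rule exists_family_few_sym_diffs) (auto simp: fP, auto simp: P_def U_def)
  then obtain \<A> where \<A>: "\<A> \<subseteq> Pow {1..n}" "2 ^ n \<le> card \<A> * 2 ^ Suc b"
      "card (bad \<A>) * 2 ^ Suc b \<le> card P"
    by auto
  have fbad: "finite (bad \<A>)" using fP by (simp add: bad_def)
  define \<B> where "\<B> = U - fst ` bad \<A>"
  have "2 * card (bad \<A>) * 2 ^ b = card (bad \<A>) * 2 ^ Suc b" by simp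
  also have "\<dots> \<le> (n choose b) * 2 ^ b" using \<A>(3) cP by (rule le_trans)
  finally have "2 * card (bad \<A>) \<le> n choose b" by (subst (asm) mult_le_cancel2) simp
  moreover have "card (fst ` bad \<A>) \<le> card (bad \<A>)" using fbad by (rule card_image_le)
  moreover have "card U - card (fst ` bad \<A>) \<le> card \<B>"
    unfolding \<B>_def using fbad by (intro diff_card_le_card_Diff) auto
  ultimately have cB: "n choose b \<le> 2 * card \<B>" using cU by linarith
  have "left_cancellative n \<A> \<B>"
    unfolding left_cancellative_def
  proof (intro conjI ballI impI)
    show "\<A> \<subseteq> Pow {1..n}" by fact
    show "\<B> \<subseteq> Pow {1..n}" by (auto simp: \<B>_def U_def)
    fix X Y B assume *: "X \<in> \<A>" "Y \<in> \<A>" "B \<in> \<B>" "X - B = Y - B"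
    show "X = Y"
    proof (rule ccontr)
      assume "X \<noteq> Y"
      \<comment> \<open>Equality outside \<open>B\<close> means that the symmetric difference lies
        inside \<open>B\<close>.\<close>
      then have "(B, sym_diff X Y) \<in> P" using * by (auto simp: P_def \<B>_def)
      then have "(B, sym_diff X Y) \<in> bad \<A>" using * unfolding bad_def by auto
      then show False using *(3) by (force simp: \<B>_def)
    qed
  qed
  then have "card \<A> * card \<B> \<le> max_left_cancellative n"
    unfolding max_left_cancellative_def
    by (intro Max_ge finite_left_cancellative_products) blast
  moreover have "(n choose b) * 2 ^ n \<le> (2 * card \<B>) * (card \<A> * 2 ^ Suc b)"
    using cB \<A>(2) by (rule mult_le_mono)
  moreover have "(2 * card \<B>) * (card \<A> * 2 ^ Suc b) = 4 * 2 ^ b * (card \<A> * card \<B>)" by simp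
  ultimately show ?thesis by (metis le_trans mult_le_mono2)
qed

text \<open>Rather than selecting the largest term, all \<open>n + 1\<close> terms of the expansion
  of \<open>(1 + 2) ^ n\<close> are bounded uniformly.\<close>

lemma max_left_cancellative_ge: "3 ^ n \<le> 4 * (n + 1) * max_left_cancellative n"
proof -
  have "3 ^ n = (1 + 2 :: nat) ^ n" by (simp only: one_plus_numeral semiring_norm)
  also have "\<dots> = (\<Sum>b\<le>n. (n choose b) * 2 ^ (n - b))" by (subst binomial) simp
  also have "\<dots> \<le> (\<Sum>b\<le>n. 4 * max_left_cancellative n)"
  proof (rule sum_mono)
    fix b assume "b \<in> {..n}"
    then have "(2::nat) ^ n = 2 ^ (n - b) * 2 ^ b" by (simp flip: power_add)
    then have "(n choose b) * 2 ^ (n - b) * 2 ^ b \<le> 4 * max_left_cancellative n * 2 ^ b"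
      using max_left_cancellative_ge_binomial[of n b] by (simp add: mult_ac)
    then show "(n choose b) * 2 ^ (n - b) \<le> 4 * max_left_cancellative n" by simp
  qed
  finally show ?thesis by (simp add: algebra_simps)
qed

text \<open>Sorting the pairs by the size of \<open>B\<close> gives the binomial expansion of
  \<open>(1 + 2) ^ card N\<close>.\<close>

lemma card_disjoint_subset_pairs:
  assumes "finite N"
  shows "card (SIGMA B:Pow N. Pow (N - B)) = 3 ^ card N"
proof -
  have "card (SIGMA B:Pow N. Pow (N - B)) = (\<Sum>B\<in>Pow N. 2 ^ (card N - card B))"
    using assms by (auto simp: card_Pow card_Diff_subset finite_subset intro!: sum.cong)
  also have "\<dots> = (\<Sum>b\<le>card N. \<Sum>B | B \<in> Pow N \<and> card B = b. 2 ^ (card N - card B))"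
    using assms by (intro sum.group[symmetric]) (auto intro: card_mono)
  also have "\<dots> = (\<Sum>b\<le>card N. (card N choose b) * 2 ^ (card N - b))"
    using assms by (intro sum.cong refl) (simp add: n_subsets)
  also have "\<dots> = (1 + 2) ^ card N" by (subst binomial) simp
  finally show ?thesis by (simp only: one_plus_numeral semiring_norm)
qed

lemma max_left_cancellative_le: "max_left_cancellative n \<le> 3 ^ n"
proof -
  have "card \<A> * card \<B> \<le> 3 ^ n" if "left_cancellative n \<A> \<B>" for \<A> \<B>
  proof -
    have "card \<A> * card \<B> = card (\<A> \<times> \<B>)" by (simp add: card_cartesian_product)
    also have "\<dots> \<le> card (SIGMA B:Pow {1..n}. Pow ({1..n} - B))"
    proof (rule card_inj_on_le[where f = "\<lambda>(A, B). (B, A - B)"])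
      \<comment> \<open>The first component reveals \<open>B\<close>, and left-cancellation then
        recovers \<open>A\<close> from \<open>A - B\<close>.\<close>
      show "inj_on (\<lambda>(A, B). (B, A - B)) (\<A> \<times> \<B>)"
        using that unfolding left_cancellative_def
        by (intro inj_onI) (clarsimp, metis)
      show "(\<lambda>(A, B). (B, A - B)) ` (\<A> \<times> \<B>) \<subseteq> (SIGMA B:Pow {1..n}. Pow ({1..n} - B))"
        using that by (fastforce simp: left_cancellative_def)
    qed auto
    also have "\<dots> = 3 ^ n" by (subst card_disjoint_subset_pairs) auto
    finally show ?thesis .
  qed
  then show ?thesis
    unfolding max_left_cancellative_def
    by (subst Max_le_iff[OF finite_left_cancellative_products left_cancellative_products_nonempty])
      blast
qed

theorem theorem1p4:
  shows "(\<lambda>n. 1 / real n * log 3 (real (max_left_cancellative n))) \<longlonglongrightarrow> 1"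
proof (rule tendsto_sandwich)
  have *: "real n - log 3 (4 * (real n + 1)) \<le> log 3 (real (max_left_cancellative n))"
      "log 3 (real (max_left_cancellative n)) \<le> real n" for n
  proof -
    define M where "M = real (max_left_cancellative n)"
    have "real (3 ^ n) \<le> real (4 * (n + 1) * max_left_cancellative n)"
      using max_left_cancellative_ge by (rule of_nat_mono)
    then have ge: "3 ^ n \<le> 4 * (real n + 1) * M" by (simp add: M_def algebra_simps)
    \<comment> \<open>Positivity, needed for the logarithms, follows from the lower bound
      itself.\<close>
    have "max_left_cancellative n \<noteq> 0" using max_left_cancellative_ge[of n] by (intro notI) simp
    then have pos: "0 < M" by (simp add: M_def)
    have "log 3 (3 ^ n) \<le> log 3 (4 * (real n + 1) * M)" using ge by (intro log_mono) auto
    then show "real n - log 3 (4 * (real n + 1)) \<le> log 3 M" using pos by (simp add: log_mult)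
    have "M \<le> 3 ^ n" using of_nat_mono[OF max_left_cancellative_le[of n], where 'a = real]
      by (simp add: M_def)
    then have "log 3 M \<le> log 3 (3 ^ n)" using pos by (intro log_mono) auto
    then show "log 3 M \<le> real n" by simp
  qed
  \<comment> \<open>Both bounds hold even at \<open>n = 0\<close>, where \<open>1 / real n\<close>
    is 0 by convention.\<close>
  show "\<forall>\<^sub>F n in sequentially. 1 / real n * (real n - log 3 (4 * (real n + 1)))
          \<le> 1 / real n * log 3 (real (max_left_cancellative n))"
    using *(1) by (intro always_eventually allI mult_left_mono) auto
  show "\<forall>\<^sub>F n in sequentially. 1 / real n * log 3 (real (max_left_cancellative n)) \<le> 1"
    using *(2) by (intro always_eventually allI) (simp add: divide_le_eq)
  \<comment> \<open>The loss is logarithmic in \<open>n\<close>, hence vanishes after division by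
    \<open>n\<close>.\<close>
  show "(\<lambda>n. 1 / real n * (real n - log 3 (4 * (real n + 1)))) \<longlonglongrightarrow> 1" by real_asymp
qed simp

end
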